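(* Let $\mathcal{X}$ be an $N$-dimensional partially observable tensor with mode lengths $I_1,\ldots,I_N$. The memory requirement of the serial SALS algorithm (described in the context) with rank $K$ and block size $C$ ($1\le C\le K$) is $$O\Bigl(C\sum_{n=1}^{N}I_n\Bigr).$$
   Context: The serial algorithm SALS (Subset Alternating Least Square) takes as input the observable entries $x_{i_1\ldots i_N}$, $(i_1,\ldots,i_N)\in\Omega$, of $\mathcal{X}\in\mathbb{R}^{I_1\times\cdots\times I_N}$, a rank $K$ and a regularization parameter $\lambda>0$, and outputs factor matrices $\mathbf{A}^{(n)}=(a^{(n)}_{i_n k})\in\mathbb{R}^{I_n\times K}$, $1\le n\le N$. It aims to minimize $\sum_{(i_1,\ldots,i_N)\in\Omega}\bigl(x_{i_1\ldots i_N}-\sum_{k=1}^{K}\prod_{n=1}^{N}a^{(n)}_{i_n k}\bigr)^2+\lambda\sum_{n=1}^{N}\|\mathbf{A}^{(n)}\|_F^2$. Here $\Omega$ is the set of indices of observable entries, tensors $\mathcal{R}$ and $\hat{\mathcal{R}}$ below are stored only at the indices in $\Omega$, and $\Omega^{(n)}_{i_n}$ denotes the subset of $\Omega$ whose $n$th mode's index equals $i_n$. Initialization: set all entries of $\mathbf{A}^{(1)}$ to $0$, those of the other factor matrices to random values, and $\mathcal{R}=\mathcal{X}$ (so that $r_{i_1\ldots i_N}=x_{i_1\ldots i_N}-\sum_{k}\prod_{n}a^{(n)}_{i_n k}$). Repeat $T_{out}$ times (outer iteration): repeat $\lceil K/C\rceil$ times the following steps (a)-(d). (a) Choose $C$ columns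 $k_1,\ldots,k_C$ among those not yet updated in the current outer iteration (the last block contains the remaining columns, if fewer than $C$). (b) Compute $\hat r_{i_1\ldots i_N}=r_{i_1\ldots i_N}+\sum_{c=1}^{C}\prod_{n=1}^{N}a^{(n)}_{i_n k_c}$ for all $(i_1,\ldots,i_N)\in\Omega$. (c) Repeat $T_{in}$ times (inner iteration): for $n=1,\ldots,N$ and for $i_n=1,\ldots,I_n$, update $$[a^{(n)}_{i_n k_1},\ldots,a^{(n)}_{i_n k_C}]^T\leftarrow(\mathbf{B}^{(n)}_{i_n}+\lambda\mathbf{I}_C)^{-1}\mathbf{c}^{(n)}_{i_n},$$ where $\mathbf{I}_C$ is the $C\times C$ identity, $\mathbf{B}^{(n)}_{i_n}\in\mathbb{R}^{C\times C}$ has $(c_1,c_2)$th entry $\sum_{(i_1,\ldots,i_N)\in\Omega^{(n)}_{i_n}}\prod_{l\ne n}a^{(l)}_{i_l k_{c_1}}\prod_{l\ne n}a^{(l)}_{i_l k_{c_2}}$, and $\mathbf{c}^{(n)}_{i_n}\in\mathbb{R}^C$ has $c$th entry $\sum_{(i_1,\ldots,i_N)\in\Omega^{(n)}_{i_n}}\hat r_{i_1\ldots i_N}\prod_{l\ne n}a^{(l)}_{i_l k_c}$. (d) Update $r_{i_1\ldots i_N}\leftarrow\hat r_{i_1\ldots i_N}-\sum_{c=1}^{C}\prod_{n=1}^{N}a^{(n)}_{i_n k_c}$ for all $(i_1,\ldots,i_N)\in\Omega$. Memory convention: the memory requirement counts the factor-matrix entries (parameters) that must be held in main memory at a time. Disk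 storage is not counted: the tensors $\mathcal{X}$, $\mathcal{R}$, $\hat{\mathcal{R}}$ and the factor-matrix columns not currently in use may be kept on disk, and tensor entries may be streamed from and to disk one by one. *)

theory Defs
  imports
    "HOL-Library.Landau_Symbols"
    "HOL-Library.FuncSet"
    "Jordan_Normal_Form.Gauss_Jordan_Elimination"
begin

text \<open>
  Modes, mode indices and columns are numbered from 1.  A tensor index
  \<open>(i\<^sub>1,\<dots>,i\<^sub>N)\<close> is an extensional function on \<open>{1..N}\<close>; the values of
  \<open>tensor\<close> outside \<open>observed\<close> are never used.
\<close>

type_synonym tindex = "nat \<Rightarrow> nat"

type_synonym factors = "nat \<Rightarrow> nat \<Rightarrow> nat \<Rightarrow> real"  \<comment> \<open>mode, row, column\<close>

record instance_data =
  num_modes :: nat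
  mode_len :: "nat \<Rightarrow> nat"
  observed :: "tindex set"
  tensor :: "tindex \<Rightarrow> real"
  num_cols :: nat       \<comment> \<open>the rank \<open>K\<close>\<close>
  block_size :: nat     \<comment> \<open>\<open>C\<close>\<close>
  reg :: real           \<comment> \<open>\<open>\<lambda>\<close>\<close>
  t_out :: nat
  t_in :: nat

definition sals_instance :: "instance_data \<Rightarrow> bool" where
  "sals_instance p \<longleftrightarrow>
     1 \<le> num_modes p \<and>
     (\<forall>n\<in>{1..num_modes p}. 1 \<le> mode_len p n) \<and>
     observed p \<subseteq> (\<Pi>\<^sub>E n\<in>{1..num_modes p}. {1..mode_len p n}) \<and>
     1 \<le> block_size p \<and> block_size p \<le> num_cols p \<and>
     0 < reg p"

definition slice :: "instance_data \<Rightarrow> nat \<Rightarrow> nat \<Rightarrow> tindex set" where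
  "slice p n i = {ix \<in> observed p. ix n = i}"

record state =
  fac :: factors
  res :: "tindex \<Rightarrow> real"
  rhat :: "tindex \<Rightarrow> real"

definition block_value :: "instance_data \<Rightarrow> factors \<Rightarrow> nat list \<Rightarrow> tindex \<Rightarrow> real" where
  "block_value p A ks ix = (\<Sum>k\<in>set ks. \<Prod>n\<in>{1..num_modes p}. A n (ix n) k)"

definition other_prod :: "instance_data \<Rightarrow> factors \<Rightarrow> nat \<Rightarrow> tindex \<Rightarrow> nat \<Rightarrow> real" where
  "other_prod p A n ix k = (\<Prod>l\<in>{1..num_modes p} - {n}. A l (ix l) k)"

definition B_mat :: "instance_data \<Rightarrow> factors \<Rightarrow> nat list \<Rightarrow> nat \<Rightarrow> nat \<Rightarrow> real mat" where
  "B_mat p A ks n i = mat (length ks) (length ks)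
     (\<lambda>(c1, c2). \<Sum>ix\<in>slice p n i. other_prod p A n ix (ks ! c1) * other_prod p A n ix (ks ! c2))"

definition c_vec ::
  "instance_data \<Rightarrow> factors \<Rightarrow> (tindex \<Rightarrow> real) \<Rightarrow> nat list \<Rightarrow> nat \<Rightarrow> nat \<Rightarrow> real vec" where
  "c_vec p A rh ks n i = vec (length ks)
     (\<lambda>c. \<Sum>ix\<in>slice p n i. rh ix * other_prod p A n ix (ks ! c))"

text \<open>
  The inverse below always exists for \<open>reg p > 0\<close>, since \<open>B_mat\<close> is positive semidefinite.
\<close>

definition new_row ::
  "instance_data \<Rightarrow> factors \<Rightarrow> (tindex \<Rightarrow> real) \<Rightarrow> nat list \<Rightarrow> nat \<Rightarrow> nat \<Rightarrow> real vec" where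
  "new_row p A rh ks n i =
     the (mat_inverse (B_mat p A ks n i + reg p \<cdot>\<^sub>m 1\<^sub>m (length ks))) *\<^sub>v c_vec p A rh ks n i"

text \<open>
  \<open>Init_Col n k v\<close> fills column \<open>k\<close> of the \<open>n\<close>th factor matrix with the values \<open>v\<close>;
  the other steps act on the block of columns \<open>ks\<close>.
\<close>

datatype step =
    Init_Col nat nat "nat \<Rightarrow> real"
  | Init_Res
  | Add_Back "nat list"
  | Update_Row nat nat "nat list"
  | Subtract "nat list"

fun apply_step :: "instance_data \<Rightarrow> step \<Rightarrow> state \<Rightarrow> state" where
  "apply_step p (Init_Col n k v) s =
     s\<lparr>fac := (\<lambda>m i j. if m = n \<and> j = k \<and> i \<in> {1..mode_len p n} then v i else fac s m i j)\<rparr>"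
| "apply_step p Init_Res s =
     s\<lparr>res := (\<lambda>ix. if ix \<in> observed p then tensor p ix else res s ix)\<rparr>"
| "apply_step p (Add_Back ks) s =
     s\<lparr>rhat := (\<lambda>ix. if ix \<in> observed p then res s ix + block_value p (fac s) ks ix
                     else rhat s ix)\<rparr>"
| "apply_step p (Update_Row n i ks) s =
     s\<lparr>fac := (\<lambda>m j k. if m = n \<and> j = i
                 then (case map_of (zip ks (list_of_vec (new_row p (fac s) (rhat s) ks n i))) k of
                         Some v \<Rightarrow> v | None \<Rightarrow> fac s m j k)
                 else fac s m j k)\<rparr>"
| "apply_step p (Subtract ks) s =
     s\<lparr>res := (\<lambda>ix. if ix \<in> observed p then rhat s ix - block_value p (fac s) ks ix
                    else res s ix)\<rparr>"

text \<open>
  The random initial values \<open>ini\<close> and the column choices are parameters.  The choices are given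
  by one partition of the columns into \<open>\<lceil>K/C\<rceil>\<close> blocks for each outer iteration.
\<close>

definition valid_blocks :: "instance_data \<Rightarrow> nat list list \<Rightarrow> bool" where
  "valid_blocks p bs \<longleftrightarrow>
     length bs = nat \<lceil>real (num_cols p) / real (block_size p)\<rceil> \<and>
     distinct (concat bs) \<and> set (concat bs) = {1..num_cols p} \<and>
     (\<forall>ks\<in>set (butlast bs). length ks = block_size p)"

definition valid_schedule :: "instance_data \<Rightarrow> nat list list list \<Rightarrow> bool" where
  "valid_schedule p sched \<longleftrightarrow> length sched = t_out p \<and> (\<forall>bs\<in>set sched. valid_blocks p bs)"

definition init_steps :: "instance_data \<Rightarrow> factors \<Rightarrow> step list" where
  "init_steps p ini =
     concat (map (\<lambda>n. map (\<lambda>k. Init_Col n k (if n = 1 then (\<lambda>_. 0) else (\<lambda>i. ini n i k)))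
                        [1..<Suc (num_cols p)])
                 [1..<Suc (num_modes p)]) @ [Init_Res]"

definition inner_steps :: "instance_data \<Rightarrow> nat list \<Rightarrow> step list" where
  "inner_steps p ks =
     concat (map (\<lambda>n. map (\<lambda>i. Update_Row n i ks) [1..<Suc (mode_len p n)])
                 [1..<Suc (num_modes p)])"

definition block_steps :: "instance_data \<Rightarrow> nat list \<Rightarrow> step list" where
  "block_steps p ks =
     Add_Back ks # concat (replicate (t_in p) (inner_steps p ks)) @ [Subtract ks]"

definition sals_steps :: "instance_data \<Rightarrow> factors \<Rightarrow> nat list list list \<Rightarrow> step list" where
  "sals_steps p ini sched =
     init_steps p ini @ concat (map (\<lambda>bs. concat (map (block_steps p) bs)) sched)"

text \<open>
  A configuration consists of the factor-matrix columns \<open>(n, k)\<close> currently held in main memory,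
  with their contents, and of the disk.  The disk contains the residual tensors and a possibly
  outdated copy of all the columns.  Columns are moved between disk and memory as a whole.
\<close>

type_synonym memory = "nat \<times> nat \<Rightarrow> (nat \<Rightarrow> real) option"

type_synonym config = "memory \<times> state"

definition all_columns :: "instance_data \<Rightarrow> (nat \<times> nat) set" where
  "all_columns p = {1..num_modes p} \<times> {1..num_cols p}"

fun step_columns :: "instance_data \<Rightarrow> step \<Rightarrow> (nat \<times> nat) set" where
  "step_columns p (Init_Col n k v) = {(n, k)}"
| "step_columns p Init_Res = {}"
| "step_columns p (Add_Back ks) = {1..num_modes p} \<times> set ks"
| "step_columns p (Update_Row n i ks) = {1..num_modes p} \<times> set ks"
| "step_columns p (Subtract ks) = {1..num_modes p} \<times> set ks"

definition entries_held :: "instance_data \<Rightarrow> memory \<Rightarrow> nat" where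
  "entries_held p mem = (\<Sum>(n, k)\<in>dom mem. mode_len p n)"

text \<open>
  A step of the algorithm sees factor-matrix entries only through main memory (absent columns
  read as unspecified values, and writes to them are lost), and it does not change the copies of
  the columns on disk.  Tensor entries are streamed from and to disk.
\<close>

definition mem_factors :: "memory \<Rightarrow> factors" where
  "mem_factors mem n i k = the (mem (n, k)) i"

definition compute :: "instance_data \<Rightarrow> step \<Rightarrow> config \<Rightarrow> config" where
  "compute p st cfg = (case cfg of (mem, dsk) \<Rightarrow>
     let s = apply_step p st (dsk\<lparr>fac := mem_factors mem\<rparr>)
     in ((\<lambda>(n, k). if (n, k) \<in> dom mem then Some (\<lambda>i. fac s n i k) else None),
         s\<lparr>fac := fac dsk\<rparr>))"

text \<open>
  \<open>executes p M cfg sts cfg'\<close>: the steps \<open>sts\<close> can be carried out in this order from \<open>cfg\<close>,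
  ending in \<open>cfg'\<close>, by interleaving them with transfers of columns such that no more than \<open>M\<close>
  factor-matrix entries are ever held in main memory.
\<close>

inductive executes :: "instance_data \<Rightarrow> nat \<Rightarrow> config \<Rightarrow> step list \<Rightarrow> config \<Rightarrow> bool"
  for p :: instance_data and M :: nat where
  finish: "entries_held p mem \<le> M \<Longrightarrow> executes p M (mem, dsk) [] (mem, dsk)"
| load: "\<lbrakk>(n, k) \<in> all_columns p; (n, k) \<notin> dom mem; entries_held p mem \<le> M;
          executes p M (mem((n, k) \<mapsto> (\<lambda>i. fac dsk n i k)), dsk) sts cfg'\<rbrakk>
         \<Longrightarrow> executes p M (mem, dsk) sts cfg'"
| store: "\<lbrakk>mem (n, k) = Some v; entries_held p mem \<le> M;
           executes p M (mem((n, k) := None),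
             dsk\<lparr>fac := (\<lambda>m i j. if m = n \<and> j = k then v i else fac dsk m i j)\<rparr>) sts cfg'\<rbrakk>
          \<Longrightarrow> executes p M (mem, dsk) sts cfg'"
| step: "\<lbrakk>step_columns p st \<subseteq> dom mem; entries_held p mem \<le> M;
          executes p M (compute p st (mem, dsk)) sts cfg'\<rbrakk>
         \<Longrightarrow> executes p M (mem, dsk) (st # sts) cfg'"

text \<open>
  Main memory is empty at the beginning and at the end.  The final disk contents have to be the
  result of SALS, computed without any distinction between memory and disk.
\<close>

definition runs_in_memory :: "instance_data \<Rightarrow> nat \<Rightarrow> bool" where
  "runs_in_memory p M \<longleftrightarrow>
     (\<forall>ini sched s. valid_schedule p sched \<longrightarrow>
        executes p M (Map.empty, s) (sals_steps p ini sched)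
          (Map.empty, fold (apply_step p) (sals_steps p ini sched) s))"

text \<open>For a valid instance some \<open>M\<close> always suffices, so \<open>LEAST\<close> is meaningful.\<close>

definition sals_memory :: "instance_data \<Rightarrow> nat" where
  "sals_memory p = (LEAST M. runs_in_memory p M)"

end

theory Submission
  imports Defs
begin

text \<open>
  Every step of SALS touches only the columns of one block (or one single column), so the block
  can be loaded, all steps on it carried out in main memory, and the block stored again.  A block
  has at most \<open>C\<close> columns in each mode, hence at most \<open>C \<cdot> (I\<^sub>1 + \<dots> + I\<^sub>N)\<close> entries.
\<close>

section \<open>Configurations as states, and locality of steps\<close>

text \<open>The state that a configuration represents: columns in memory supersede their disk copies.\<close>

definition overlay :: "memory \<Rightarrow> state \<Rightarrow> state" where
  "overlay mem dsk =
     dsk\<lparr>fac := (\<lambda>n i k. case mem (n, k) of Some v \<Rightarrow> v i | None \<Rightarrow> fac dsk n i k)\<rparr>"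

lemma overlay_sel [simp]:
  "fac (overlay mem dsk) n i k = (case mem (n, k) of Some v \<Rightarrow> v i | None \<Rightarrow> fac dsk n i k)"
  "res (overlay mem dsk) = res dsk"
  "rhat (overlay mem dsk) = rhat dsk"
  by (simp_all add: overlay_def)

lemma overlay_empty [simp]: "overlay Map.empty s = s"
  by (simp add: overlay_def)

lemma overlay_eqI:
  assumes "\<And>n i k. (case mem (n, k) of Some v \<Rightarrow> v i | None \<Rightarrow> fac dsk n i k) = fac s n i k"
    and "res dsk = res s" "rhat dsk = rhat s"
  shows "overlay mem dsk = s"
  using assms by (intro state.equality) (auto simp: fun_eq_iff)

lemma block_value_cong:
  assumes "\<And>n i k. n \<in> {1..num_modes p} \<Longrightarrow> k \<in> set ks \<Longrightarrow> A n i k = A' n i k"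
  shows "block_value p A ks ix = block_value p A' ks ix"
  unfolding block_value_def using assms by (intro sum.cong prod.cong) auto

lemma new_row_cong:
  assumes "\<And>n i k. n \<in> {1..num_modes p} \<Longrightarrow> k \<in> set ks \<Longrightarrow> A n i k = A' n i k"
  shows "new_row p A rh ks n i = new_row p A' rh ks n i"
proof -
  have other: "other_prod p A n ix (ks ! c) = other_prod p A' n ix (ks ! c)"
    if "c < length ks" for ix c
    unfolding other_prod_def using assms that by (intro prod.cong) auto
  have "B_mat p A ks n i = B_mat p A' ks n i"
    unfolding B_mat_def by (rule cong_mat) (auto simp: other intro!: sum.cong)
  moreover have "c_vec p A rh ks n i = c_vec p A' rh ks n i"
    unfolding c_vec_def by (auto simp: other intro!: sum.cong)
  ultimately show ?thesis
    by (simp add: new_row_def)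
qed

text \<open>\<open>Update_Row n i ks\<close> writes to mode \<open>n\<close>, while its
  \<open>step_columns\<close> cover only the modes from 1 to \<open>num_modes p\<close>. For
  \<open>n\<close> outside this range the step could change a column that it does not
  declare.\<close>

fun well_formed_step :: "instance_data \<Rightarrow> step \<Rightarrow> bool" where
  "well_formed_step p (Update_Row n i ks) \<longleftrightarrow> n \<in> {1..num_modes p}"
| "well_formed_step p _ \<longleftrightarrow> True"

lemma mem_factors_eq_overlay:
  "(n, k) \<in> dom mem \<Longrightarrow> mem_factors mem n i k = fac (overlay mem dsk) n i k"
  by (auto simp: mem_factors_def)

lemma apply_step_unchanged:
  assumes "well_formed_step p st" "(n, k) \<notin> step_columns p st"
  shows "fac (apply_step p st s) n i k = fac s n i k"
proof (cases st)
  case (Update_Row m j ks)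
  \<comment> \<open>The new row is paired with \<open>ks\<close>, so a column outside
    \<open>ks\<close> has no entry and the \<open>None\<close> branch keeps its old value.\<close>
  have "map_of (zip ks ys) k = None" if "k \<notin> set ks" for ys :: "real list"
    using that by (auto simp: map_of_eq_None_iff dest: set_zip_leftD)
  then show ?thesis
    using assms Update_Row by auto
qed (use assms in auto)

text \<open>A step reads only the columns in \<open>step_columns\<close>. These are in memory, where
  \<open>mem_factors\<close> agrees with \<open>overlay\<close>, so the unspecified values of absent
  columns never enter the tensors or the columns held.\<close>

lemma apply_step_local:
  fixes dsk :: state
  assumes "step_columns p st \<subseteq> dom mem" "well_formed_step p st"
  defines "s \<equiv> apply_step p st (dsk\<lparr>fac := mem_factors mem\<rparr>)"
    and "t \<equiv> apply_step p st (overlay mem dsk)"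
  shows "(n, k) \<in> dom mem \<Longrightarrow> fac s n i k = fac t n i k" and "res s = res t" and "rhat s = rhat t"
proof -
  have eq: "mem_factors mem n i k = fac (overlay mem dsk) n i k" if "(n, k) \<in> step_columns p st"
    for n i k using that assms(1) mem_factors_eq_overlay by blast
  have "((n, k) \<in> dom mem \<longrightarrow> fac s n i k = fac t n i k) \<and> res s = res t \<and> rhat s = rhat t"
  proof (cases st)
    case (Add_Back ks)
    have "block_value p (mem_factors mem) ks ix = block_value p (fac (overlay mem dsk)) ks ix" for ix
      by (rule block_value_cong) (use eq Add_Back in auto)
    then show ?thesis
      by (auto simp: s_def t_def Add_Back mem_factors_def)
  next
    case (Subtract ks)
    have "block_value p (mem_factors mem) ks ix = block_value p (fac (overlay mem dsk)) ks ix" for ix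
      by (rule block_value_cong) (use eq Subtract in auto)
    then show ?thesis
      by (auto simp: s_def t_def Subtract mem_factors_def)
  next
    case (Update_Row m j ks)
    have "new_row p (mem_factors mem) rh ks m j = new_row p (fac (overlay mem dsk)) rh ks m j" for rh
      by (rule new_row_cong) (use eq Update_Row in auto)
    then show ?thesis
      by (auto simp: s_def t_def Update_Row mem_factors_def split: option.split)
  qed (auto simp: s_def t_def mem_factors_def)
  then show "(n, k) \<in> dom mem \<Longrightarrow> fac s n i k = fac t n i k" "res s = res t" "rhat s = rhat t"
    by auto
qed

text \<open>Columns in memory are right by locality. Columns that are only on disk lie outside
  \<open>step_columns\<close>, so their copies, which \<open>compute\<close> leaves alone, are still
  current afterwards.\<close>

lemma compute_overlay:
  assumes "step_columns p st \<subseteq> dom mem" "well_formed_step p st"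
  obtains mem' dsk' where "compute p st (mem, dsk) = (mem', dsk')" "dom mem' = dom mem"
    "overlay mem' dsk' = apply_step p st (overlay mem dsk)"
proof -
  define s where "s = apply_step p st (dsk\<lparr>fac := mem_factors mem\<rparr>)"
  define mem' where "mem' = (\<lambda>(n, k). if (n, k) \<in> dom mem then Some (\<lambda>i. fac s n i k) else None)"
  note local = apply_step_local[OF assms, where dsk = dsk, folded s_def]
  have "overlay mem' (s\<lparr>fac := fac dsk\<rparr>) = apply_step p st (overlay mem dsk)"
  proof (rule overlay_eqI)
    fix n i k
    show "(case mem' (n, k) of Some v \<Rightarrow> v i | None \<Rightarrow> fac (s\<lparr>fac := fac dsk\<rparr>) n i k) =
      fac (apply_step p st (overlay mem dsk)) n i k"
    proof (cases "(n, k) \<in> dom mem")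
      case True
      then show ?thesis by (simp add: mem'_def local(1))
    next
      case False
      then have "(n, k) \<notin> step_columns p st" using assms by blast
      with False show ?thesis
        by (auto simp: mem'_def apply_step_unchanged[OF assms(2)] split: option.split)
    qed
  qed (simp_all add: local)
  moreover have "compute p st (mem, dsk) = (mem', s\<lparr>fac := fac dsk\<rparr>)"
    unfolding compute_def Let_def s_def mem'_def by simp
  moreover have "dom mem' = dom mem"
    by (auto simp: mem'_def split: if_splits)
  ultimately show ?thesis using that by blast
qed

section \<open>Transfers between disk and main memory\<close>

lemma entries_held_cong: "dom mem = dom mem' \<Longrightarrow> entries_held p mem = entries_held p mem'"
  by (simp add: entries_held_def)

lemma entries_held_mono:
  "finite (dom mem') \<Longrightarrow> dom mem \<subseteq> dom mem' \<Longrightarrow> entries_held p mem \<le> entries_held p mem'"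
  unfolding entries_held_def by (rule sum_mono2) auto

text \<open>Writing a column back keeps the represented state and only shrinks the memory. Once the
  memory is empty, the disk itself is that state.\<close>

lemma executes_store_all:
  assumes "finite (dom mem)" "entries_held p mem \<le> M"
    and "executes p M (Map.empty, overlay mem dsk) sts cfg"
  shows "executes p M (mem, dsk) sts cfg"
  using assms
proof (induction "dom mem" arbitrary: mem dsk rule: finite_psubset_induct)
  case psubset
  show ?case
  proof (cases "dom mem = {}")
    case True
    with psubset.prems show ?thesis by simp
  next
    case False
    then obtain n k v where v: "mem (n, k) = Some v" by (auto simp: dom_def)
    define mem' where "mem' = mem((n, k) := None)"
    define dsk' where "dsk' = dsk\<lparr>fac := (\<lambda>m i j. if m = n \<and> j = k then v i else fac dsk m i j)\<rparr>"
    have "dom mem' \<subset> dom mem"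
      using v by (auto simp: mem'_def)
    moreover from this have "entries_held p mem' \<le> M"
      using entries_held_mono[of mem mem' p] psubset by auto
    moreover have "overlay mem' dsk' = overlay mem dsk"
      by (rule overlay_eqI) (auto simp: mem'_def dsk'_def v split: option.split)
    ultimately have "executes p M (mem', dsk') sts cfg"
      using psubset.hyps psubset.prems by simp
    then show ?thesis
      using executes.store[OF v psubset.prems(1)] by (simp add: mem'_def dsk'_def)
  qed
qed

text \<open>A loaded column is a copy of the disk, so \<open>overlay\<close> does not change.
  Loading never lowers the occupancy, so the bound for the final \<open>dom mem \<union> D\<close>
  covers all intermediate configurations.\<close>

lemma executes_load_all:
  assumes "finite D" "D \<subseteq> all_columns p" "finite (dom mem)" "D \<inter> dom mem = {}"
    and "(\<Sum>(n, k)\<in>dom mem \<union> D. mode_len p n) \<le> M"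
    and "\<And>mem'. dom mem' = dom mem \<union> D \<Longrightarrow> overlay mem' dsk = overlay mem dsk
           \<Longrightarrow> executes p M (mem', dsk) sts cfg"
  shows "executes p M (mem, dsk) sts cfg"
  using assms
proof (induction D arbitrary: mem rule: finite_induct)
  case empty
  then show ?case by simp
next
  case (insert c D)
  obtain n k where c: "c = (n, k)" by (cases c)
  define mem1 where "mem1 = mem((n, k) \<mapsto> (\<lambda>i. fac dsk n i k))"
  have none: "mem (n, k) = None" using insert.prems c by auto
  have dom1: "dom mem1 = insert c (dom mem)" by (auto simp: mem1_def c)
  have ov: "overlay mem1 dsk = overlay mem dsk"
    by (rule overlay_eqI) (auto simp: mem1_def none)
  have un: "dom mem1 \<union> D = dom mem \<union> insert c D" using dom1 by blast
  have "executes p M (mem1, dsk) sts cfg"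
  proof (rule insert.IH)
    show "D \<subseteq> all_columns p" "finite (dom mem1)" "D \<inter> dom mem1 = {}"
      using insert.hyps insert.prems(1-3) by (auto simp: dom1)
    show "(\<Sum>(n, k)\<in>dom mem1 \<union> D. mode_len p n) \<le> M"
      using insert.prems(4) by (simp only: un)
    show "executes p M (mem', dsk) sts cfg"
      if "dom mem' = dom mem1 \<union> D" "overlay mem' dsk = overlay mem1 dsk" for mem'
      using that by (intro insert.prems(5)) (simp_all only: un ov)
  qed
  moreover have "entries_held p mem \<le> M"
  proof (rule order_trans[OF _ insert.prems(4)])
    show "entries_held p mem \<le> (\<Sum>(n, k)\<in>dom mem \<union> insert c D. mode_len p n)"
      unfolding entries_held_def using insert.hyps insert.prems(2) by (intro sum_mono2) auto
  qed
  ultimately show ?case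
    using insert.prems(1) none unfolding mem1_def
    by (rule_tac executes.load[where n = n and k = k]) (auto simp: c)
qed

text \<open>Steps preserve the domain of the memory, so the occupancy stays constant while
  \<open>sts\<close> runs. Storing all columns afterwards turns the represented state into the disk
  contents.\<close>

lemma executes_steps_in_memory:
  assumes "\<And>st. st \<in> set sts \<Longrightarrow> step_columns p st \<subseteq> dom mem \<and> well_formed_step p st"
    and "finite (dom mem)" "entries_held p mem \<le> M"
    and "executes p M (Map.empty, fold (apply_step p) sts (overlay mem dsk)) rest cfg"
  shows "executes p M (mem, dsk) (sts @ rest) cfg"
  using assms
proof (induction sts arbitrary: mem dsk)
  case Nil
  then show ?case by (simp add: executes_store_all)
next
  case (Cons st sts)
  obtain mem' dsk' where step: "compute p st (mem, dsk) = (mem', dsk')" "dom mem' = dom mem"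
    "overlay mem' dsk' = apply_step p st (overlay mem dsk)"
    using compute_overlay[of p st mem dsk] Cons.prems(1) by auto
  have "executes p M (mem', dsk') (sts @ rest) cfg"
    using Cons.prems entries_held_cong[OF step(2)] by (intro Cons.IH) (auto simp: step)
  then show ?case
    using Cons.prems executes.step[of p st mem M dsk "sts @ rest" cfg] by (simp add: step(1))
qed

section \<open>Composing runs that start and end with empty memory\<close>

text \<open>\<open>executes\<close> is built from the front towards a fixed final configuration.
  Leaving \<open>rest\<close> and \<open>cfg\<close> arbitrary makes the property compose under
  \<open>@\<close>, and empty memory at both ends lets successive pieces use different
  columns.\<close>

definition fits_in_memory :: "instance_data \<Rightarrow> nat \<Rightarrow> step list \<Rightarrow> bool" where
  "fits_in_memory p M sts \<longleftrightarrow>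
     (\<forall>s rest cfg. executes p M (Map.empty, fold (apply_step p) sts s) rest cfg
        \<longrightarrow> executes p M (Map.empty, s) (sts @ rest) cfg)"

lemma fits_in_memory_append:
  "fits_in_memory p M xs \<Longrightarrow> fits_in_memory p M ys \<Longrightarrow> fits_in_memory p M (xs @ ys)"
  by (simp add: fits_in_memory_def)

lemma fits_in_memory_concat:
  "(\<And>xs. xs \<in> set xss \<Longrightarrow> fits_in_memory p M xs) \<Longrightarrow> fits_in_memory p M (concat xss)"
proof (induction xss)
  case Nil
  then show ?case by (simp add: fits_in_memory_def)
qed (simp add: fits_in_memory_append)

text \<open>Load \<open>D\<close>, run \<open>sts\<close>, store everything: the occupancy peaks at
  the columns of \<open>D\<close>, however many steps there are.\<close>

lemma fits_in_memory_columns: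
  assumes "D \<subseteq> all_columns p" "(\<Sum>(n, k)\<in>D. mode_len p n) \<le> M"
    and "\<And>st. st \<in> set sts \<Longrightarrow> step_columns p st \<subseteq> D \<and> well_formed_step p st"
  shows "fits_in_memory p M sts"
  unfolding fits_in_memory_def
proof (intro allI impI)
  fix s rest cfg
  assume run: "executes p M (Map.empty, fold (apply_step p) sts s) rest cfg"
  have fin: "finite D"
    using assms(1) by (rule finite_subset) (simp add: all_columns_def)
  show "executes p M (Map.empty, s) (sts @ rest) cfg"
  proof (rule executes_load_all[OF fin assms(1)])
    fix mem' :: memory
    assume "dom mem' = dom Map.empty \<union> D" "overlay mem' s = overlay Map.empty s"
    then show "executes p M (mem', s) (sts @ rest) cfg"
      using assms fin run by (intro executes_steps_in_memory) (auto simp: entries_held_def)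
  qed (use assms in auto)
qed

section \<open>Block sizes and the memory bound\<close>

text \<open>\<open>valid_blocks\<close> fixes the length of every block but the last. Counting
  bounds the last one: the blocks partition \<open>K\<close> columns into
  \<open>\<lceil>K/C\<rceil>\<close> lists, which leaves
  \<open>K - (\<lceil>K/C\<rceil> - 1) * C \<le> C\<close> columns.\<close>

lemma block_length_le:
  assumes "sals_instance p" "valid_blocks p bs" "ks \<in> set bs"
  shows "length ks \<le> block_size p"
proof -
  define C K where "C = block_size p" and "K = num_cols p"
  have C: "1 \<le> C" "C \<le> K" using assms(1) by (auto simp: sals_instance_def C_def K_def)
  have bs: "butlast bs @ [last bs] = bs"
    using assms(3) by (intro append_butlast_last_id) auto
  have butlast: "\<forall>ks\<in>set (butlast bs). length ks = C"
    using assms(2) by (simp add: valid_blocks_def C_def)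
  then have "map length (butlast bs) = replicate (length bs - 1) C"
    by (simp add: list_eq_iff_nth_eq)
  moreover have "concat bs = concat (butlast bs) @ last bs"
    by (subst bs[symmetric]) simp
  ultimately have "length (concat bs) = (length bs - 1) * C + length (last bs)"
    by (simp add: length_concat sum_list_replicate)
  moreover have "length (concat bs) = K"
    using assms(2) distinct_card[of "concat bs"] by (simp add: valid_blocks_def K_def)
  moreover have "K \<le> length bs * C"
  proof -
    have "real K / real C \<le> real (length bs)"
      using assms(2) by (simp add: valid_blocks_def C_def K_def)
    then have "real K \<le> real (length bs * C)"
      using C by (simp add: field_simps)
    then show ?thesis by linarith
  qed
  \<comment> \<open>\<open>bs\<close> contains \<open>ks\<close>, so it is nonempty and the
    natural-number subtraction does not truncate.\<close>
  moreover have "length bs * C = (length bs - 1) * C + C"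
    using assms(3) by (cases bs) auto
  ultimately have "length (last bs) \<le> C"
    by linarith
  moreover have "ks \<in> set (butlast bs) \<or> ks = last bs"
    using assms(3) bs by (metis Un_iff empty_iff insert_iff list.set set_append)
  ultimately show ?thesis using butlast by (auto simp: C_def)
qed

lemma runs_in_memory_block_size:
  assumes p: "sals_instance p"
  shows "runs_in_memory p (block_size p * (\<Sum>n=1..num_modes p. mode_len p n))"
proof -
  define M where "M = block_size p * (\<Sum>n=1..num_modes p. mode_len p n)"
  have C: "1 \<le> block_size p" using p by (simp add: sals_instance_def)
  have init: "fits_in_memory p M [Init_Col n k v]"
    if "n \<in> {1..num_modes p}" "k \<in> {1..num_cols p}" for n k v
  proof (rule fits_in_memory_columns[of "{(n, k)}"])
    \<comment> \<open>As \<open>1 \<le> block_size p\<close>, \<open>M\<close> is at least the sum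
      of all mode lengths, so one column of any mode fits.\<close>
    have "mode_len p n \<le> (\<Sum>n=1..num_modes p. mode_len p n)"
      using that by (intro member_le_sum) auto
    also have "\<dots> \<le> M" using C by (simp add: M_def)
    finally show "(\<Sum>(n, k)\<in>{(n, k)}. mode_len p n) \<le> M" by simp
  qed (use that in \<open>auto simp: all_columns_def\<close>)
  have cols: "fits_in_memory p M (map (\<lambda>k. Init_Col n k (v k)) [1..<Suc (num_cols p)])"
    if "n \<in> {1..num_modes p}" for n v
  proof -
    \<comment> \<open>Splitting into singletons lets each column be stored before the next is
      loaded; a whole factor matrix held at once could exceed \<open>M\<close>.\<close>
    have "fits_in_memory p M (concat (map (\<lambda>k. [Init_Col n k (v k)]) [1..<Suc (num_cols p)]))"
      by (rule fits_in_memory_concat) (use that in \<open>auto intro!: init\<close>)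
    then show ?thesis by simp
  qed
  have res: "fits_in_memory p M [Init_Res]"
    by (rule fits_in_memory_columns[of "{}"]) auto
  have inits: "fits_in_memory p M (init_steps p ini)" for ini
    unfolding init_steps_def
    by (intro fits_in_memory_append fits_in_memory_concat res) (auto intro!: cols simp del: upt_Suc One_nat_def)
  have block: "fits_in_memory p M (block_steps p ks)" if "valid_blocks p bs" "ks \<in> set bs" for bs ks
  \<comment> \<open>The columns of a block stay in memory from \<open>Add_Back\<close> to
    \<open>Subtract\<close>, through all inner iterations.\<close>
  proof (rule fits_in_memory_columns[of "{1..num_modes p} \<times> set ks"])
    show "{1..num_modes p} \<times> set ks \<subseteq> all_columns p"
      using that by (auto simp: valid_blocks_def all_columns_def)
    have "(\<Sum>(n, k)\<in>{1..num_modes p} \<times> set ks. mode_len p n)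
        = card (set ks) * (\<Sum>n=1..num_modes p. mode_len p n)"
      by (simp add: sum.cartesian_product[symmetric] sum_distrib_left)
    also have "card (set ks) \<le> block_size p"
      using block_length_le[OF p that] card_length[of ks] by linarith
    finally show "(\<Sum>(n, k)\<in>{1..num_modes p} \<times> set ks. mode_len p n) \<le> M"
      by (simp add: M_def)
  qed (auto simp: block_steps_def inner_steps_def simp del: upt_Suc split: if_splits)
  have "executes p M (Map.empty, s) (sals_steps p ini sched)
      (Map.empty, fold (apply_step p) (sals_steps p ini sched) s)"
    if "valid_schedule p sched" for ini sched s
  proof -
    have "fits_in_memory p M (sals_steps p ini sched)"
      unfolding sals_steps_def
      by (intro fits_in_memory_append fits_in_memory_concat inits)
        (use that in \<open>auto simp: valid_schedule_def intro!: fits_in_memory_concat block\<close>)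
    \<comment> \<open>The empty continuation closes the run.\<close>
    moreover have "executes p M (Map.empty, t) [] (Map.empty, t)" for t
      by (rule executes.finish) (simp add: entries_held_def)
    ultimately show ?thesis
      unfolding fits_in_memory_def by (metis append_Nil2)
  qed
  then show ?thesis
    by (simp add: runs_in_memory_def M_def)
qed

theorem theorem3:
  "(\<lambda>p. real (sals_memory p))
     \<in> O[principal {p. sals_instance p}](\<lambda>p. real (block_size p * (\<Sum>n=1..num_modes p. mode_len p n)))"
\<comment> \<open>The constant 1 works because the bound holds without any further factor; for the
  principal filter, "eventually" means for every valid instance.\<close>
proof (rule bigoI[of _ 1])
  have "sals_memory p \<le> block_size p * (\<Sum>n=1..num_modes p. mode_len p n)" if "sals_instance p" for p
    unfolding sals_memory_def by (intro Least_le runs_in_memory_block_size that)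
  then show "\<forall>\<^sub>F p in principal {p. sals_instance p}. norm (real (sals_memory p))
      \<le> 1 * norm (real (block_size p * (\<Sum>n=1..num_modes p. mode_len p n)))"
    by (simp add: eventually_principal del: of_nat_mult of_nat_sum)
qed

end
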